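(* Let $F$ be a field with $\operatorname{char}(F)\neq 2,3$, let $K/F$ be a quadratic étale extension with non-trivial Galois automorphism $\sigma$, let $\mathcal{J}=(J,N,\sharp,T,1)$ be a cubic norm structure over $K$, and let $\varphi\in\operatorname{Str}(\mathcal{J})$ be a $\sigma$-semilinear self-adjoint autotopy of $\mathcal{J}$. Let $\delta:=N(\varphi(1))$, and assume that there is an element $\gamma\in K$ such that $\gamma^{\sigma+1}=\delta^{-1}$; in particular, $\delta\in F$. Define maps $\hat N\colon J\to K$, $\hat\sharp\colon J\to J$, $\hat\times\colon J\times J\to J$ and $\hat T\colon J\times J\to K$ by $$\hat N(a):=\gamma^{-1}N(a),\qquad a^{\hat\sharp}:=\gamma\,\varphi(a)^\sharp,\qquad a\mathbin{\hat\times}b:=\gamma\,(\varphi(a)\times\varphi(b)),\qquad \hat T(a,b):=T(a,\varphi(b))$$ for all $a,b\in J$. Then $\mathcal{K}:=(J,\hat N,\hat\sharp,\hat T)$ is a hermitian cubic norm structure over $K/F$.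
   Context: **Conventions.** A quadratic étale extension $K/F$ is either a separable quadratic field extension or the split algebra $F\oplus F$ (with $\sigma$ the exchange map). For $t\in K$ write $t^\sigma=\sigma(t)$, $t^{\sigma+1}=t^\sigma t$, $t^{2\sigma}=(t^\sigma)^2$. **Cubic norm structure.** A cubic norm structure over a commutative associative $F$-algebra $K$ is a quintuple $\mathcal{J}=(J,N,\sharp,T,1)$, where $J$ is a left $K$-module, $N\colon J\to K$, $\sharp\colon J\to J$, $a\mapsto a^\sharp$, are maps, $T\colon J\times J\to K$ is a symmetric $K$-bilinear form and $1\in J\setminus\{0\}$, such that with $a\times b:=(a+b)^\sharp-a^\sharp-b^\sharp$, for all $t\in K$, $a,b\in J$: (i) $(ta)^\sharp=t^2a^\sharp$; (ii) $N(ta)=t^3N(a)$; (iii) $N(a+b)=N(a)+T(b,a^\sharp)+T(a,b^\sharp)+N(b)$; (iv) $a^{\sharp\sharp}=N(a)a$; (v) $1^\sharp=1$; (vi) $b=T(b,1)1-1\times b$. Put $U_a(b):=T(a,b)a-a^\sharp\times b$. An element $a\in J$ is invertible if $N(a)$ is invertible in $K$. **Autotopies.** For invertible $z\in J$, put $a^{\sharp_z}:=N(z)^{-1}U_z(a^\sharp)$. A map $\varphi\colon J\to J$ is $\sigma$-semilinear if it is additive and $\varphi(ta)=t^\sigma\varphi(a)$ for all $t\in K$, $a\in J$. A $\sigma$-semilinear bijection $\varphi\colon J\to J$ such that $z:=\varphi(1)$ is invertible is an autotopy of $\mathcal{J}$ if $\varphi(a^\sharp)=\varphi(a)^{\sharp_z}$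 for all $a\in J$. $\operatorname{Str}(\mathcal{J})$ is the group of all autotopies (over all $\sigma\in\operatorname{Aut}(K)$). The adjoint of $\varphi$ is $\check\varphi:=\varphi^{-1}U_z$, and $\varphi$ is self-adjoint if $\check\varphi=\varphi$. **Hermitian cubic norm structure.** A hermitian (non-unital) cubic norm structure over $K/F$ is a quadruple $(J,N,\sharp,T)$, where $J$ is a left $K$-module, $N\colon J\to K$ is a non-zero map, $\sharp\colon J\to J$, $a\mapsto a^\sharp$, is a map, and $T\colon J\times J\to K$ is a hermitian form (biadditive, $T(sa,tb)=st^\sigma T(a,b)$ and $T(a,b)^\sigma=T(b,a)$), such that for all $t\in K$, $a,b\in J$: (i) $(ta)^\sharp=t^{2\sigma}a^\sharp$; (ii) $N(ta)=t^3N(a)$; (iii) $N(a+b)=N(a)+T(b,a^\sharp)+T(a,b^\sharp)+N(b)$; (iv) $a^{\sharp\sharp}=N(a)a$. Its associated product is $a\times b:=(a+b)^\sharp-a^\sharp-b^\sharp$. *)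

theory Defs
  imports "HOL-Computational_Algebra.Computational_Algebra"
begin

section \<open>Quadratic etale extensions\<close>

text \<open>
  Only used at invertible elements, where it is the inverse; a commutative ring type
  need not carry a division operation.
\<close>
definition unit_inv :: "'k::comm_ring_1 \<Rightarrow> 'k" where
  "unit_inv x = (THE y. x * y = 1)"

definition is_ring_hom :: "('r::comm_ring_1 \<Rightarrow> 's::comm_ring_1) \<Rightarrow> bool" where
  "is_ring_hom h \<longleftrightarrow>
     h 1 = 1 \<and> (\<forall>x y. h (x + y) = h x + h y) \<and> (\<forall>x y. h (x * y) = h x * h y)"

definition is_ring_aut :: "('k::comm_ring_1 \<Rightarrow> 'k) \<Rightarrow> bool" where
  "is_ring_aut \<sigma> \<longleftrightarrow> is_ring_hom \<sigma> \<and> bij \<sigma>"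

text \<open>
  The structure of \<open>'k\<close> as an algebra over the field \<open>'f\<close> is given by the structure
  homomorphism \<open>\<iota>\<close>; it is automatically injective, since \<open>'k\<close> is nontrivial.
\<close>

definition is_separable_over :: "('f::field \<Rightarrow> 'k::comm_ring_1) \<Rightarrow> 'k \<Rightarrow> bool" where
  "is_separable_over \<iota> x \<longleftrightarrow>
     (\<exists>p. irreducible p \<and> poly (map_poly \<iota> p) x = 0 \<and> coprime p (pderiv p))"

definition separable_quadratic_field_ext :: "('f::field \<Rightarrow> 'k::comm_ring_1) \<Rightarrow> bool" where
  "separable_quadratic_field_ext \<iota> \<longleftrightarrow>
     (\<forall>x::'k. x \<noteq> 0 \<longrightarrow> x dvd 1) \<and>
     vector_space.dim (\<lambda>c x. \<iota> c * x) (UNIV :: 'k set) = 2 \<and>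
     (\<forall>x. is_separable_over \<iota> x)"

definition nontrivial_galois_aut ::
  "('f::field \<Rightarrow> 'k::comm_ring_1) \<Rightarrow> ('k \<Rightarrow> 'k) \<Rightarrow> bool" where
  "nontrivial_galois_aut \<iota> \<sigma> \<longleftrightarrow> is_ring_aut \<sigma> \<and> (\<forall>c. \<sigma> (\<iota> c) = \<iota> c) \<and> \<sigma> \<noteq> id"

text \<open>
  \<open>p\<^sub>1\<close> and \<open>p\<^sub>2\<close> are the two coordinates of an isomorphism of algebras from \<open>'k\<close> onto
  \<open>'f \<oplus> 'f\<close>, under which \<open>\<sigma>\<close> becomes the exchange map.
\<close>
definition split_quadratic_with_exchange ::
  "('f::field \<Rightarrow> 'k::comm_ring_1) \<Rightarrow> ('k \<Rightarrow> 'k) \<Rightarrow> bool" where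
  "split_quadratic_with_exchange \<iota> \<sigma> \<longleftrightarrow>
     (\<exists>p\<^sub>1 p\<^sub>2. is_ring_hom p\<^sub>1 \<and> is_ring_hom p\<^sub>2 \<and> bij (\<lambda>x. (p\<^sub>1 x, p\<^sub>2 x)) \<and>
        (\<forall>c. p\<^sub>1 (\<iota> c) = c \<and> p\<^sub>2 (\<iota> c) = c) \<and>
        (\<forall>x. p\<^sub>1 (\<sigma> x) = p\<^sub>2 x \<and> p\<^sub>2 (\<sigma> x) = p\<^sub>1 x))"

definition quadratic_etale ::
  "('f::field \<Rightarrow> 'k::comm_ring_1) \<Rightarrow> ('k \<Rightarrow> 'k) \<Rightarrow> bool" where
  "quadratic_etale \<iota> \<sigma> \<longleftrightarrow> is_ring_hom \<iota> \<and>
     (separable_quadratic_field_ext \<iota> \<and> nontrivial_galois_aut \<iota> \<sigma> \<or>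
      split_quadratic_with_exchange \<iota> \<sigma>)"

section \<open>Cubic norm structures\<close>

definition sharp_cross :: "('j::ab_group_add \<Rightarrow> 'j) \<Rightarrow> 'j \<Rightarrow> 'j \<Rightarrow> 'j" where
  "sharp_cross sharp a b = sharp (a + b) - sharp a - sharp b"

locale cubic_norm_structure = module scale
  for scale :: "'k::comm_ring_1 \<Rightarrow> 'j::ab_group_add \<Rightarrow> 'j" +
  fixes N :: "'j \<Rightarrow> 'k"
    and sharp :: "'j \<Rightarrow> 'j"
    and T :: "'j \<Rightarrow> 'j \<Rightarrow> 'k"
    and e :: 'j
  assumes T_sym: "T a b = T b a"
    and T_add: "T (a + b) c = T a c + T b c"
    and T_scale: "T (scale t a) b = t * T a b"
    and e_nonzero: "e \<noteq> 0"
    and sharp_scale: "sharp (scale t a) = scale (t\<^sup>2) (sharp a)"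
    and N_scale: "N (scale t a) = t ^ 3 * N a"
    and N_add: "N (a + b) = N a + T b (sharp a) + T a (sharp b) + N b"
    and sharp_sharp: "sharp (sharp a) = scale (N a) a"
    and sharp_e: "sharp e = e"
    and e_cross: "b = scale (T b e) e - sharp_cross sharp e b"

definition U_op ::
  "('k::comm_ring_1 \<Rightarrow> 'j::ab_group_add \<Rightarrow> 'j) \<Rightarrow> ('j \<Rightarrow> 'j) \<Rightarrow> ('j \<Rightarrow> 'j \<Rightarrow> 'k) \<Rightarrow> 'j \<Rightarrow> 'j \<Rightarrow> 'j"
  where "U_op scale sharp T a b = scale (T a b) a - sharp_cross sharp (sharp a) b"

definition cns_invertible :: "('j \<Rightarrow> 'k::comm_ring_1) \<Rightarrow> 'j \<Rightarrow> bool" where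
  "cns_invertible N a \<longleftrightarrow> N a dvd 1"

section \<open>Autotopies\<close>

definition isotope_sharp ::
  "('k::comm_ring_1 \<Rightarrow> 'j::ab_group_add \<Rightarrow> 'j) \<Rightarrow> ('j \<Rightarrow> 'k) \<Rightarrow> ('j \<Rightarrow> 'j) \<Rightarrow>
     ('j \<Rightarrow> 'j \<Rightarrow> 'k) \<Rightarrow> 'j \<Rightarrow> 'j \<Rightarrow> 'j"
  where "isotope_sharp scale N sharp T z a =
           scale (unit_inv (N z)) (U_op scale sharp T z (sharp a))"

definition semilinear ::
  "('k::comm_ring_1 \<Rightarrow> 'j::ab_group_add \<Rightarrow> 'j) \<Rightarrow> ('k \<Rightarrow> 'k) \<Rightarrow> ('j \<Rightarrow> 'j) \<Rightarrow> bool" where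
  "semilinear scale \<sigma> \<phi> \<longleftrightarrow>
     (\<forall>a b. \<phi> (a + b) = \<phi> a + \<phi> b) \<and> (\<forall>t a. \<phi> (scale t a) = scale (\<sigma> t) (\<phi> a))"

definition Str ::
  "('k::comm_ring_1 \<Rightarrow> 'j::ab_group_add \<Rightarrow> 'j) \<Rightarrow> ('j \<Rightarrow> 'k) \<Rightarrow> ('j \<Rightarrow> 'j) \<Rightarrow>
     ('j \<Rightarrow> 'j \<Rightarrow> 'k) \<Rightarrow> 'j \<Rightarrow> ('j \<Rightarrow> 'j) set"
  where "Str scale N sharp T e =
    {\<phi>. (\<exists>\<sigma>. is_ring_aut \<sigma> \<and> semilinear scale \<sigma> \<phi>) \<and> bij \<phi> \<and>
         cns_invertible N (\<phi> e) \<and>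
         (\<forall>a. \<phi> (sharp a) = isotope_sharp scale N sharp T (\<phi> e) (\<phi> a))}"

definition autotopy_adjoint ::
  "('k::comm_ring_1 \<Rightarrow> 'j::ab_group_add \<Rightarrow> 'j) \<Rightarrow> ('j \<Rightarrow> 'j) \<Rightarrow> ('j \<Rightarrow> 'j \<Rightarrow> 'k) \<Rightarrow> 'j \<Rightarrow>
     ('j \<Rightarrow> 'j) \<Rightarrow> ('j \<Rightarrow> 'j)"
  where "autotopy_adjoint scale sharp T e \<phi> = inv \<phi> \<circ> U_op scale sharp T (\<phi> e)"

definition self_adjoint_autotopy ::
  "('k::comm_ring_1 \<Rightarrow> 'j::ab_group_add \<Rightarrow> 'j) \<Rightarrow> ('j \<Rightarrow> 'j) \<Rightarrow> ('j \<Rightarrow> 'j \<Rightarrow> 'k) \<Rightarrow> 'j \<Rightarrow>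
     ('j \<Rightarrow> 'j) \<Rightarrow> bool"
  where "self_adjoint_autotopy scale sharp T e \<phi> \<longleftrightarrow>
           autotopy_adjoint scale sharp T e \<phi> = \<phi>"

section \<open>Hermitian cubic norm structures\<close>

locale hermitian_cubic_norm_structure = module scale
  for scale :: "'k::comm_ring_1 \<Rightarrow> 'j::ab_group_add \<Rightarrow> 'j" +
  fixes \<iota> :: "'f::field \<Rightarrow> 'k"
    and \<sigma> :: "'k \<Rightarrow> 'k"
    and N :: "'j \<Rightarrow> 'k"
    and sharp :: "'j \<Rightarrow> 'j"
    and T :: "'j \<Rightarrow> 'j \<Rightarrow> 'k"
  assumes etale: "quadratic_etale \<iota> \<sigma>"
    and N_nonzero: "\<exists>a. N a \<noteq> 0"
    and T_add_left: "T (a + b) c = T a c + T b c"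
    and T_add_right: "T a (b + c) = T a b + T a c"
    and T_scale: "T (scale s a) (scale t b) = s * \<sigma> t * T a b"
    and T_hermitian: "\<sigma> (T a b) = T b a"
    and sharp_scale: "sharp (scale t a) = scale ((\<sigma> t)\<^sup>2) (sharp a)"
    and N_scale: "N (scale t a) = t ^ 3 * N a"
    and N_add: "N (a + b) = N a + T b (sharp a) + T a (sharp b) + N b"
    and sharp_sharp: "sharp (sharp a) = scale (N a) a"

end

theory Submission
  imports Defs
begin

text \<open>
  Write \<open>z = \<phi>(1)\<close>, so that \<open>\<delta> = N(z)\<close>. Self-adjointness says \<open>U\<^sub>z = \<phi>\<^sup>2\<close>. Substituted in the
  defining identity \<open>\<phi>(a\<^sup>\<sharp>) = \<delta>\<inverse> U\<^sub>z(\<phi>(a)\<^sup>\<sharp>)\<close> of an autotopy this gives, after cancelling one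
  \<open>\<phi>\<close>,
    \<open>\<phi>(\<phi>(a)\<^sup>\<sharp>) = \<delta> a\<^sup>\<sharp>\<close>  (\<open>map_sharp_map\<close>),
  and everything else is drawn from this identity.

  For the new structure the identity says that \<open>\<phi>\<close> maps \<open>\<gamma> \<phi>(a)\<^sup>\<sharp>\<close> to \<open>\<gamma>\<^sup>\<sigma> \<delta> a\<^sup>\<sharp> = \<gamma>\<inverse> a\<^sup>\<sharp>\<close>.
  This turns the expansion of \<open>N(a + b)\<close> and the rule \<open>a\<^sup>\<sharp>\<^sup>\<sharp> = N(a) a\<close> into the corresponding
  axioms of a hermitian structure.

  The axiom with content is the hermitian symmetry of \<open>T(a, \<phi>(b))\<close>. Put \<open>\<psi>(a) = \<phi>(a)\<^sup>\<sharp>\<close>.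
  Computing \<open>\<phi>(\<psi>(\<psi>(a)))\<close> in two ways yields \<open>N(\<phi>(a)) \<phi>(a) = \<delta> N(a)\<^sup>\<sigma> \<phi>(a)\<close>; since \<open>K\<close> is
  reduced, the vector \<open>\<phi>(a)\<close> can be cancelled, and \<open>\<phi>\<close> is a norm similarity (\<open>norm_map\<close>). As
  2 is not a zero divisor, the part of this identity linear in \<open>b\<close> can be split off at
  \<open>a + b\<close>, giving \<open>T(\<phi>(b), \<phi>(a)\<^sup>\<sharp>) = \<delta> T(b, a\<^sup>\<sharp>)\<^sup>\<sigma>\<close>, where \<open>\<delta> a\<^sup>\<sharp>\<close> may be rewritten as
  \<open>\<phi>(\<phi>(a)\<^sup>\<sharp>)\<close>. This is hermitian symmetry whenever one argument is of the form \<open>\<phi>(a)\<^sup>\<sharp>\<close>. These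
  elements are all values of \<open>\<sharp>\<close>, because \<open>\<phi>\<close> is onto, and the axiom
  \<open>b = T(b,1) 1 - 1 \<times> b\<close> shows that the values of \<open>\<sharp>\<close> span \<open>J\<close>.

  Four properties of \<open>K\<close> carry the argument: \<open>\<sigma>\<close> is an involutory ring homomorphism, its fixed ring is
  \<open>F\<close>, \<open>K\<close> is reduced, and 2 is not a zero divisor in \<open>K\<close>.
\<close>

section \<open>Quadratic etale extensions\<close>

lemma mult_cancel_unit:
  fixes x :: "'k::comm_ring_1"
  assumes "x * y = 1"
  shows "y * (x * t) = t"
proof -
  have "y * (x * t) = x * y * t" by (simp only: mult_ac)
  then show ?thesis using assms by simp
qed

lemma unit_inv_mult:
  assumes "x dvd (1::'k::comm_ring_1)"
  shows "x * unit_inv x = 1"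
proof -
  obtain y where y: "x * y = 1" using assms by (metis dvdE)
  have "y' = y" if "x * y' = 1" for y'
    using mult_cancel_unit[OF y, of y'] that by simp
  then show ?thesis unfolding unit_inv_def by (rule theI[of "\<lambda>y. x * y = 1", OF y])
qed

lemma ring_hom_minus:
  assumes "is_ring_hom h"
  shows "h 0 = 0" and "h (- x) = - h x" and "h (x - y) = h x - h y"
proof -
  have add: "h (x + y) = h x + h y" for x y using assms by (simp add: is_ring_hom_def)
  show 0: "h 0 = 0" using add[of 0 0] by simp
  have m: "h (- x) = - h x" for x using add[of x "- x"] 0 by (simp add: add_eq_0_iff)
  show "h (- x) = - h x" by (rule m)
  show "h (x - y) = h x - h y" using add[of x "- y"] m by simp
qed

lemma ring_hom_power:
  assumes "is_ring_hom h"
  shows "h (x ^ n) = h x ^ n"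
  using assms by (induction n) (auto simp: is_ring_hom_def)

text \<open>
  A vector outside the span would make three independent vectors, more than a basis of two
  elements allows. Dimension 2 excludes an infinite basis, whose cardinality counts as 0.
\<close>
lemma (in vector_space) pair_spans_of_dim_2:
  assumes "dim UNIV = 2" and "independent {u, v}" and "u \<noteq> v"
  shows "y \<in> span {u, v}"
proof (rule ccontr)
  assume y: "y \<notin> span {u, v}"
  obtain B where B: "independent B" "UNIV \<subseteq> span B" "card B = dim UNIV"
    using basis_exists[of UNIV] by metis
  have "finite B" using B(3) assms(1) by (intro card_ge_0_finite) simp
  moreover have "independent {y, u, v}"
    by (rule independent_insertI[OF y assms(2)])
  ultimately have "card {y, u, v} \<le> card B"
    using independent_span_bound[of B "{y, u, v}"] B(2) by auto
  moreover have "y \<noteq> u" "y \<noteq> v" using y span_base by blast+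
  ultimately show False using B(3) assms(1,3) by simp
qed

text \<open>
  An element \<open>x\<close> moved by \<open>\<sigma>\<close> generates \<open>K\<close> over \<open>F\<close>. It satisfies a quadratic equation over
  \<open>F\<close>, and so does \<open>\<sigma>(x)\<close>; hence \<open>\<sigma>(x)\<close> is the other root \<open>b - x\<close>, which decides everything
  about \<open>\<sigma>\<close>.
\<close>
lemma quadratic_field_ext_galois:
  fixes \<iota> :: "'f::field \<Rightarrow> 'k::comm_ring_1"
  assumes \<iota>: "is_ring_hom \<iota>" and ext: "separable_quadratic_field_ext \<iota>"
    and gal: "nontrivial_galois_aut \<iota> \<sigma>"
  shows "\<sigma> (\<sigma> y) = y" and "\<sigma> y = y \<Longrightarrow> y \<in> range \<iota>"
proof -
  have \<iota>_simps: "\<iota> 1 = 1" "\<iota> (a + b) = \<iota> a + \<iota> b" "\<iota> (a * b) = \<iota> a * \<iota> b" for a b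
    using \<iota> by (auto simp: is_ring_hom_def)
  interpret V: vector_space "\<lambda>c x. \<iota> c * x"
    by unfold_locales (auto simp: \<iota>_simps algebra_simps)
  have \<sigma>: "is_ring_hom \<sigma>" using gal by (auto simp: nontrivial_galois_aut_def is_ring_aut_def)
  then have \<sigma>_simps: "\<sigma> 1 = 1" "\<sigma> (a + b) = \<sigma> a + \<sigma> b" "\<sigma> (a * b) = \<sigma> a * \<sigma> b" for a b
    by (auto simp: is_ring_hom_def)
  have \<sigma>\<iota>: "\<sigma> (\<iota> c) = \<iota> c" for c using gal by (auto simp: nontrivial_galois_aut_def)
  have cancel: "b = 0" if "a * b = 0" "a \<noteq> 0" for a b :: 'k
  proof -
    have "a dvd 1" using ext that(2) by (simp add: separable_quadratic_field_ext_def)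
    then have "a * unit_inv a = 1" by (rule unit_inv_mult)
    then show ?thesis using mult_cancel_unit[of a "unit_inv a" b] that(1) by simp
  qed
  obtain x where x: "\<sigma> x \<noteq> x"
    using gal by (auto simp: nontrivial_galois_aut_def fun_eq_iff)
  have x1: "x \<noteq> 1" using x \<sigma>_simps(1) by auto
  have x\<iota>: "x \<noteq> \<iota> c" for c using x \<sigma>\<iota> by auto
  have "V.independent {x, 1}"
    using x\<iota> by (auto simp: V.independent_insert V.span_singleton)
  then have "y \<in> V.span {x, 1}" for y
    using V.pair_spans_of_dim_2[of x 1 y] ext x1
    by (simp add: separable_quadratic_field_ext_def)
  then have gen: "\<exists>a b. y = \<iota> a + \<iota> b * x" for y
    by (simp add: V.span_insert V.span_singleton image_iff diff_eq_eq) metis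
  obtain a b where ab: "x * x = \<iota> a + \<iota> b * x" using gen by blast
  have "\<sigma> x * \<sigma> x = \<iota> a + \<iota> b * \<sigma> x"
    using arg_cong[OF ab, of \<sigma>] by (simp add: \<sigma>_simps \<sigma>\<iota>)
  then have "(\<sigma> x - x) * (\<sigma> x + x - \<iota> b) = 0" using ab by (simp add: algebra_simps)
  then have "\<sigma> x + x - \<iota> b = 0" by (rule cancel) (simp add: x)
  then have \<sigma>x: "\<sigma> x = \<iota> b - x" by (simp add: algebra_simps)
  obtain c d where y: "y = \<iota> c + \<iota> d * x" using gen by blast
  show "\<sigma> (\<sigma> y) = y"
    by (simp add: y \<sigma>_simps \<sigma>\<iota> \<sigma>x ring_hom_minus[OF \<sigma>])
  assume "\<sigma> y = y"
  then have "(\<sigma> x - x) * \<iota> d = 0" by (simp add: y \<sigma>_simps \<sigma>\<iota> algebra_simps)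
  then have "\<iota> d = 0" by (rule cancel) (simp add: x)
  then show "y \<in> range \<iota>" using y by simp
qed

lemma split_quadratic_exchange:
  assumes "split_quadratic_with_exchange \<iota> \<sigma>"
  shows "is_ring_hom \<sigma>" and "\<sigma> (\<sigma> y) = y" and "\<sigma> y = y \<Longrightarrow> y \<in> range \<iota>"
    and "y * y = 0 \<Longrightarrow> y = 0"
proof -
  obtain p q where pq: "is_ring_hom p" "is_ring_hom q" "bij (\<lambda>x. (p x, q x))"
      "\<And>c. p (\<iota> c) = c" "\<And>c. q (\<iota> c) = c" "\<And>x. p (\<sigma> x) = q x" "\<And>x. q (\<sigma> x) = p x"
    using assms unfolding split_quadratic_with_exchange_def by blast
  have eqI: "x = y" if "p x = p y" "q x = q y" for x y
    using pq(3) that by (auto simp: bij_def inj_def)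
  have homs: "p 1 = 1" "p (x + y) = p x + p y" "p (x * y) = p x * p y" "p 0 = 0"
      "q 1 = 1" "q (x + y) = q x + q y" "q (x * y) = q x * q y" "q 0 = 0" for x y
    using pq(1,2) by (simp_all add: is_ring_hom_def ring_hom_minus)
  show "is_ring_hom \<sigma>"
    unfolding is_ring_hom_def by (intro conjI allI eqI) (simp_all add: homs pq(6,7))
  show "\<sigma> (\<sigma> y) = y" by (rule eqI) (simp_all add: pq(6,7))
  show "y \<in> range \<iota>" if "\<sigma> y = y"
  proof -
    have "p y = q y" using that pq(6)[of y] by simp
    then have "y = \<iota> (p y)" by (intro eqI) (simp_all add: pq(4,5))
    then show ?thesis by blast
  qed
  show "y = 0" if "y * y = 0"
  proof (rule eqI)
    show "p y = p 0" using arg_cong[OF that, of p] by (simp add: homs)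
    show "q y = q 0" using arg_cong[OF that, of q] by (simp add: homs)
  qed
qed

lemma quadratic_etale_involution:
  assumes "quadratic_etale \<iota> \<sigma>"
  shows "is_ring_hom \<sigma>" and "\<sigma> (\<sigma> y) = y"
proof -
  consider "split_quadratic_with_exchange \<iota> \<sigma>"
    | "is_ring_hom \<iota>" "separable_quadratic_field_ext \<iota>" "nontrivial_galois_aut \<iota> \<sigma>"
    using assms by (auto simp: quadratic_etale_def)
  then have "is_ring_hom \<sigma> \<and> \<sigma> (\<sigma> y) = y"
  proof cases
    case 1
    then show ?thesis by (simp add: split_quadratic_exchange(1)[OF 1] split_quadratic_exchange(2)[OF 1])
  next
    case 2
    moreover have "is_ring_hom \<sigma>"
      using 2(3) by (simp add: nontrivial_galois_aut_def is_ring_aut_def)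
    ultimately show ?thesis by (simp add: quadratic_field_ext_galois(1)[OF 2])
  qed
  then show "is_ring_hom \<sigma>" and "\<sigma> (\<sigma> y) = y" by auto
qed

lemma quadratic_etale_fixed:
  assumes "quadratic_etale \<iota> \<sigma>" and "\<sigma> y = y"
  shows "y \<in> range \<iota>"
proof (cases "split_quadratic_with_exchange \<iota> \<sigma>")
  case True
  then show ?thesis using assms(2) by (rule split_quadratic_exchange(3))
next
  case False
  then have "is_ring_hom \<iota>" "separable_quadratic_field_ext \<iota>" "nontrivial_galois_aut \<iota> \<sigma>"
    using assms(1) by (simp_all add: quadratic_etale_def)
  then show ?thesis using assms(2) by (rule quadratic_field_ext_galois(2))
qed

lemma quadratic_etale_reduced:
  fixes \<iota> :: "'f::field \<Rightarrow> 'k::comm_ring_1"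
  assumes "quadratic_etale \<iota> \<sigma>" and "y * y = (0::'k)"
  shows "y = 0"
proof (cases "separable_quadratic_field_ext \<iota>")
  case True
  show ?thesis
  proof (rule ccontr)
    assume "y \<noteq> 0"
    then have "y * unit_inv y = 1"
      using True by (simp add: separable_quadratic_field_ext_def unit_inv_mult)
    from mult_cancel_unit[OF this, of y] show False using assms(2) \<open>y \<noteq> 0\<close> by simp
  qed
next
  case False
  then have "split_quadratic_with_exchange \<iota> \<sigma>" using assms(1) by (simp add: quadratic_etale_def)
  then show ?thesis using assms(2) by (rule split_quadratic_exchange(4))
qed

lemma quadratic_etale_2_torsion_free:
  fixes \<iota> :: "'f::field \<Rightarrow> 'k::comm_ring_1"
  assumes "quadratic_etale \<iota> \<sigma>" and "CHAR('f) \<noteq> 2" and "y + y = (0::'k)"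
  shows "y = 0"
proof -
  have \<iota>: "is_ring_hom \<iota>" using assms(1) by (simp add: quadratic_etale_def)
  have "of_nat 2 \<noteq> (0::'f)"
  proof
    assume "of_nat 2 = (0::'f)"
    then have "CHAR('f) dvd 2" by (simp only: of_nat_eq_0_iff_char_dvd)
    then have "CHAR('f) = 1" using assms(2) two_is_prime_nat by (metis prime_nat_iff)
    then show False by simp
  qed
  then have "1 / 2 + 1 / 2 = (1::'f)" by simp
  then have "\<iota> (1 / 2) + \<iota> (1 / 2) = 1" using \<iota> unfolding is_ring_hom_def by metis
  then have "y = \<iota> (1 / 2) * (y + y)" by (metis distrib_left distrib_right mult_1)
  then show ?thesis using assms(3) by simp
qed

section \<open>Semilinear self-adjoint autotopies\<close>

locale self_adjoint_semilinear_autotopy = cubic_norm_structure scale N sharp T e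
  for scale :: "'k::comm_ring_1 \<Rightarrow> 'j::ab_group_add \<Rightarrow> 'j"
    and N :: "'j \<Rightarrow> 'k" and sharp :: "'j \<Rightarrow> 'j" and T :: "'j \<Rightarrow> 'j \<Rightarrow> 'k" and e :: 'j +
  fixes \<sigma> :: "'k \<Rightarrow> 'k" and \<phi> :: "'j \<Rightarrow> 'j"
  assumes \<sigma>_hom: "is_ring_hom \<sigma>" and \<sigma>_invol: "\<sigma> (\<sigma> t) = t"
    and autotopy: "\<phi> \<in> Str scale N sharp T e"
    and semilin: "semilinear scale \<sigma> \<phi>"
    and self_adj: "self_adjoint_autotopy scale sharp T e \<phi>"
    and \<sigma>_multiplier: "\<sigma> (N (\<phi> e)) = N (\<phi> e)"
begin

lemma T_add_right: "T a (b + c) = T a b + T a c"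
  using T_add T_sym by metis

lemma T_scale_right: "T a (scale t b) = t * T a b"
  using T_scale T_sym by metis

lemma T_minus_left: "T (- a) b = - T a b"
  using T_scale[of "-1" a b] by simp

lemma T_diff_right: "T a (b - c) = T a b - T a c"
  using T_add_right[of a "b - c" c] by simp

lemma sharp_minus: "sharp (- a) = sharp a"
  using sharp_scale[of "-1" a] by simp

lemma bij_map: "bij \<phi>"
  using autotopy by (simp add: Str_def)

lemma map_add: "\<phi> (a + b) = \<phi> a + \<phi> b" and map_scale: "\<phi> (scale t a) = scale (\<sigma> t) (\<phi> a)"
  using semilin by (auto simp: semilinear_def)

lemma map_minus: "\<phi> (- a) = - \<phi> a"
  using map_scale[of "-1" a] \<sigma>_hom ring_hom_minus(2)[OF \<sigma>_hom, of 1] by (simp add: is_ring_hom_def)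

lemma map_diff: "\<phi> (a - b) = \<phi> a - \<phi> b"
  using map_add[of a "- b"] map_minus by simp

lemma map_eq_0: "\<phi> a = 0 \<Longrightarrow> a = 0"
  using bij_map map_diff[of 0 0] by (metis bij_is_inj diff_self injD)

lemma multiplier_unit: "N (\<phi> e) * unit_inv (N (\<phi> e)) = 1"
  using autotopy by (intro unit_inv_mult) (simp add: Str_def cns_invertible_def)

lemma U_op_map_e: "U_op scale sharp T (\<phi> e) a = \<phi> (\<phi> a)"
proof -
  have "inv \<phi> (U_op scale sharp T (\<phi> e) a) = \<phi> a"
    using self_adj by (metis autotopy_adjoint_def comp_apply self_adjoint_autotopy_def)
  then show ?thesis using bij_map by (metis bij_inv_eq_iff)
qed

text \<open>
  The defining identity of an autotopy, with \<open>U\<^sub>z = \<phi>\<^sup>2\<close> inserted, has \<open>\<phi>\<close> outermost on both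
  sides once \<open>\<delta>\<close>, which \<open>\<sigma>\<close> fixes, is moved inside; injectivity of \<open>\<phi>\<close> then cancels it.
\<close>
lemma map_sharp_map: "\<phi> (sharp (\<phi> a)) = scale (N (\<phi> e)) (sharp a)"
proof -
  have "\<forall>a. \<phi> (sharp a) = isotope_sharp scale N sharp T (\<phi> e) (\<phi> a)"
    using autotopy by (simp add: Str_def)
  then have autotopy_eq: "\<phi> (sharp a) = scale (unit_inv (N (\<phi> e))) (\<phi> (\<phi> (sharp (\<phi> a))))"
    unfolding isotope_sharp_def U_op_map_e by blast
  have "\<phi> (scale (N (\<phi> e)) (sharp a)) = scale (N (\<phi> e)) (\<phi> (sharp a))"
    by (simp add: map_scale \<sigma>_multiplier)
  also have "\<dots> = \<phi> (\<phi> (sharp (\<phi> a)))"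
    by (subst autotopy_eq) (simp add: multiplier_unit)
  finally show ?thesis using bij_map by (metis bij_is_inj injD)
qed

text \<open>
  With \<open>\<psi>(a) = \<phi>(a)\<^sup>\<sharp>\<close>, both sides times \<open>\<delta>\<close> equal \<open>\<phi>(\<psi>(\<psi>(a)))\<close>.
\<close>
lemma norm_map_scale: "scale (N (\<phi> a)) (\<phi> a) = scale (N (\<phi> e) * \<sigma> (N a)) (\<phi> a)"
proof -
  define d where "d = N (\<phi> e)"
  have "sharp (\<phi> (sharp (\<phi> a))) = scale (d\<^sup>2 * N a) a"
    by (simp add: map_sharp_map sharp_scale sharp_sharp d_def)
  then have "\<phi> (sharp (\<phi> (sharp (\<phi> a)))) = scale (d * (d * \<sigma> (N a))) (\<phi> a)"
    using \<sigma>_hom by (simp add: map_scale \<sigma>_multiplier d_def is_ring_hom_def power2_eq_square mult.assoc)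
  moreover have "\<phi> (sharp (\<phi> (sharp (\<phi> a)))) = scale (d * N (\<phi> a)) (\<phi> a)"
    by (simp add: map_sharp_map[of "sharp (\<phi> a)"] sharp_sharp d_def)
  ultimately have "scale (unit_inv d) (scale (d * N (\<phi> a)) (\<phi> a))
      = scale (unit_inv d) (scale (d * (d * \<sigma> (N a))) (\<phi> a))" by simp
  moreover have "unit_inv d * (d * t) = t" for t
    unfolding d_def by (rule mult_cancel_unit[OF multiplier_unit])
  ultimately show ?thesis by (simp add: d_def)
qed

text \<open>
  The vector \<open>\<phi>(a)\<close> may have zero divisors as annihilators, but a scalar \<open>x\<close> annihilating it
  satisfies \<open>x\<^sup>3 N(\<phi>(a)) = N(x \<phi>(a)) = 0\<close>. As \<open>\<phi>(x\<^sup>\<sigma> a) = x \<phi>(a)\<close>, the conjugate \<open>x\<^sup>\<sigma>\<close>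
  annihilates \<open>a\<close>, so that likewise \<open>x\<^sup>3 N(a)\<^sup>\<sigma> = 0\<close>. For the difference \<open>x\<close> of the two sides this
  gives \<open>x\<^sup>4 = 0\<close>.
\<close>
lemma norm_map:
  assumes reduced: "\<And>x::'k. x * x = 0 \<Longrightarrow> x = 0"
  shows "N (\<phi> a) = N (\<phi> e) * \<sigma> (N a)"
proof -
  define x where "x = N (\<phi> a) - N (\<phi> e) * \<sigma> (N a)"
  have "scale x (\<phi> a) = 0" using norm_map_scale[of a] by (simp add: x_def scale_left_diff_distrib)
  moreover have N0: "N 0 = 0" using N_scale[of 0 0] by simp
  ultimately have 1: "x ^ 3 * N (\<phi> a) = 0" using N_scale[of x "\<phi> a"] by simp
  have "\<phi> (scale (\<sigma> x) a) = 0" using \<open>scale x (\<phi> a) = 0\<close> by (simp add: map_scale \<sigma>_invol)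
  then have "\<sigma> x ^ 3 * N a = 0" using map_eq_0[of "scale (\<sigma> x) a"] N_scale[of "\<sigma> x" a] N0 by simp
  then have "\<sigma> (\<sigma> x ^ 3 * N a) = 0" using ring_hom_minus(1)[OF \<sigma>_hom] by simp
  then have 2: "x ^ 3 * \<sigma> (N a) = 0"
    using \<sigma>_hom by (simp add: is_ring_hom_def ring_hom_power[OF \<sigma>_hom] \<sigma>_invol)
  have "x ^ 3 * x = x ^ 3 * N (\<phi> a) - N (\<phi> e) * (x ^ 3 * \<sigma> (N a))"
    by (simp add: x_def algebra_simps)
  then have "(x * x) * (x * x) = 0" using 1 2 by (simp add: power3_eq_cube mult.assoc)
  then have "x = 0" using reduced by blast
  then show ?thesis by (simp add: x_def)
qed

text \<open>
  The part of \<open>N(a + b)\<close> linear in \<open>b\<close> is isolated by comparing \<open>b\<close> with \<open>-b\<close>.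
\<close>
lemma trace_map_sharp:
  assumes reduced: "\<And>x::'k. x * x = 0 \<Longrightarrow> x = 0"
    and torsion_free: "\<And>x::'k. x + x = 0 \<Longrightarrow> x = 0"
  shows "T (\<phi> b) (sharp (\<phi> a)) = N (\<phi> e) * \<sigma> (T b (sharp a))"
proof -
  define x where "x b = T (\<phi> b) (sharp (\<phi> a)) - N (\<phi> e) * \<sigma> (T b (sharp a))" for b
  define y where "y b = T (\<phi> a) (sharp (\<phi> b)) - N (\<phi> e) * \<sigma> (T a (sharp b))" for b
  have "x b + y b = 0" for b
    using norm_map[OF reduced, of "a + b"] norm_map[OF reduced, of a] norm_map[OF reduced, of b] \<sigma>_hom
    by (simp add: x_def y_def map_add N_add is_ring_hom_def algebra_simps)
  from this[of b] this[of "- b"] have "x b + y b = 0" "- x b + y b = 0"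
    by (simp_all add: x_def y_def map_minus sharp_minus T_minus_left ring_hom_minus[OF \<sigma>_hom])
  then have "x b + x b = 0" by (simp add: add_eq_0_iff2)
  then have "x b = 0" by (rule torsion_free)
  then show ?thesis by (simp add: x_def)
qed

text \<open>
  Once the claim is known for \<open>b\<close> in the image of \<open>\<sharp>\<close>, the decomposition
  \<open>b = T(b,1) 1 - (1 + b)\<^sup>\<sharp> + 1\<^sup>\<sharp> + b\<^sup>\<sharp>\<close> with \<open>1 = 1\<^sup>\<sharp>\<close> extends it to all \<open>b\<close>.
\<close>
lemma trace_map_hermitian:
  assumes reduced: "\<And>x::'k. x * x = 0 \<Longrightarrow> x = 0"
    and torsion_free: "\<And>x::'k. x + x = 0 \<Longrightarrow> x = 0"
  shows "\<sigma> (T a (\<phi> b)) = T b (\<phi> a)"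
proof -
  have sharp_case: "\<sigma> (T a (\<phi> (sharp c))) = T (sharp c) (\<phi> a)" for c
  proof -
    obtain c' where c: "c = \<phi> c'" using bij_map by (metis bij_pointE)
    have "\<sigma> (T a (\<phi> (sharp c))) = N (\<phi> e) * \<sigma> (T a (sharp c'))"
      using \<sigma>_hom by (simp add: c map_sharp_map T_scale_right is_ring_hom_def \<sigma>_multiplier)
    also have "\<dots> = T (sharp c) (\<phi> a)"
      using trace_map_sharp[OF reduced torsion_free, of a c'] T_sym c by simp
    finally show ?thesis .
  qed
  define t where "t = T b e"
  have b: "b = scale t (sharp e) - (sharp (e + b) - sharp e - sharp b)"
    using e_cross[of b] by (simp add: t_def sharp_e sharp_cross_def)
  have "\<sigma> (T a (\<phi> b)) = t * \<sigma> (T a (\<phi> (sharp e))) - (\<sigma> (T a (\<phi> (sharp (e + b))))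
      - \<sigma> (T a (\<phi> (sharp e))) - \<sigma> (T a (\<phi> (sharp b))))"
    using \<sigma>_hom
    by (subst b) (simp add: map_diff map_scale T_diff_right T_scale_right is_ring_hom_def
        \<sigma>_invol ring_hom_minus[OF \<sigma>_hom])
  also have "\<dots> = t * T (\<phi> a) (sharp e) - (T (\<phi> a) (sharp (e + b))
      - T (\<phi> a) (sharp e) - T (\<phi> a) (sharp b))"
    unfolding sharp_case by (simp add: T_sym)
  also have "\<dots> = T (\<phi> a) (scale t (sharp e) - (sharp (e + b) - sharp e - sharp b))"
    by (simp add: T_diff_right T_scale_right)
  also have "\<dots> = T (\<phi> a) b" by (simp only: b[symmetric])
  finally show ?thesis by (simp add: T_sym)
qed

end

section \<open>The hermitian cubic norm structure\<close>

theorem theorem4p6: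
  fixes \<iota> :: "'f::field \<Rightarrow> 'k::comm_ring_1"
    and \<sigma> :: "'k \<Rightarrow> 'k"
    and scale :: "'k \<Rightarrow> 'j::ab_group_add \<Rightarrow> 'j"
    and N :: "'j \<Rightarrow> 'k"
    and sharp :: "'j \<Rightarrow> 'j"
    and T :: "'j \<Rightarrow> 'j \<Rightarrow> 'k"
    and e :: 'j
    and \<phi> :: "'j \<Rightarrow> 'j"
    and \<gamma> \<delta> :: 'k
    and Nhat :: "'j \<Rightarrow> 'k"
    and sharphat :: "'j \<Rightarrow> 'j"
    and crosshat :: "'j \<Rightarrow> 'j \<Rightarrow> 'j"
    and That :: "'j \<Rightarrow> 'j \<Rightarrow> 'k"
  assumes "CHAR('f) \<noteq> 2" and "CHAR('f) \<noteq> 3"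
    and "quadratic_etale \<iota> \<sigma>"
    and "cubic_norm_structure scale N sharp T e"
    and "\<phi> \<in> Str scale N sharp T e"
    and "semilinear scale \<sigma> \<phi>"
    and "self_adjoint_autotopy scale sharp T e \<phi>"
    and "\<delta> = N (\<phi> e)"
    and "\<sigma> \<gamma> * \<gamma> = unit_inv \<delta>"
    and "\<And>a. Nhat a = unit_inv \<gamma> * N a"
    and "\<And>a. sharphat a = scale \<gamma> (sharp (\<phi> a))"
    and "\<And>a b. crosshat a b = scale \<gamma> (sharp_cross sharp (\<phi> a) (\<phi> b))"
    and "\<And>a b. That a b = T a (\<phi> b)"
  shows "\<delta> \<in> range \<iota> \<and>
    hermitian_cubic_norm_structure scale \<iota> \<sigma> Nhat sharphat That \<and>
    (\<forall>a b. crosshat a b = sharp_cross sharphat a b)"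
proof -
  interpret C: cubic_norm_structure scale N sharp T e by fact
  have \<sigma>: "is_ring_hom \<sigma>" and \<sigma>_invol: "\<sigma> (\<sigma> t) = t" for t
    using quadratic_etale_involution[OF assms(3)] by auto
  then have \<sigma>_mult: "\<sigma> (x * y) = \<sigma> x * \<sigma> y" and \<sigma>_1: "\<sigma> 1 = 1" for x y
    by (auto simp: is_ring_hom_def)
  have "\<delta> dvd 1" using assms(5,8) by (simp add: Str_def cns_invertible_def)
  then have "\<delta> * (\<sigma> \<gamma> * \<gamma>) = 1" using unit_inv_mult assms(9) by metis
  then have \<delta>\<gamma>: "\<gamma> * (\<sigma> \<gamma> * \<delta>) = 1" by (simp add: mult_ac)
  then have \<gamma>_inv: "\<gamma> * unit_inv \<gamma> = 1" by (intro unit_inv_mult dvdI) simp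
  have \<gamma>_inv_eq: "unit_inv \<gamma> = \<sigma> \<gamma> * \<delta>"
    using mult_cancel_unit[OF \<gamma>_inv, of "\<sigma> \<gamma> * \<delta>"] \<delta>\<gamma> by simp
  \<comment> \<open>Both \<open>\<delta>\<close> and its conjugate are inverse to the norm of \<open>\<gamma>\<close>.\<close>
  have \<sigma>\<delta>: "\<sigma> \<delta> = \<delta>"
  proof -
    have "\<gamma> * \<sigma> \<gamma> * \<sigma> \<delta> = 1"
      using arg_cong[OF \<delta>\<gamma>, of \<sigma>] by (simp add: \<sigma>_mult \<sigma>_invol \<sigma>_1 mult_ac)
    moreover have "\<gamma> * \<sigma> \<gamma> * \<delta> = 1" using \<delta>\<gamma> by (simp add: mult.assoc)
    ultimately show ?thesis
      using mult_cancel_unit[of "\<gamma> * \<sigma> \<gamma>" \<delta> "\<sigma> \<delta>"] by simp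
  qed
  interpret A: self_adjoint_semilinear_autotopy scale N sharp T e \<sigma> \<phi>
    using \<sigma> \<sigma>_invol assms(5-8) \<sigma>\<delta> by unfold_locales auto
  have reduced: "x = 0" if "x * x = 0" for x :: 'k
    using quadratic_etale_reduced assms(3) that by blast
  have torsion_free: "x = 0" if "x + x = 0" for x :: 'k
    using quadratic_etale_2_torsion_free assms(3,1) that by blast
  \<comment> \<open>Carries the expansion of \<open>N\<close> and the double adjoint over to the new structure.\<close>
  have \<phi>_sharphat: "\<phi> (sharphat a) = scale (unit_inv \<gamma>) (sharp a)" for a
    by (simp add: assms(11) A.map_scale A.map_sharp_map \<gamma>_inv_eq flip: assms(8))
  have "hermitian_cubic_norm_structure scale \<iota> \<sigma> Nhat sharphat That"
  proof (unfold_locales)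
    show "quadratic_etale \<iota> \<sigma>" by fact
    \<comment> \<open>Up to invertible factors, \<open>Nhat (\<phi> e)\<close> is the unit \<open>\<delta>\<close>.\<close>
    have "\<gamma> * (\<sigma> \<gamma> * (\<gamma> * Nhat (\<phi> e))) = \<gamma> * (\<sigma> \<gamma> * \<delta>)"
      using \<gamma>_inv by (simp add: assms(8,10) flip: mult.assoc)
    then show "\<exists>a. Nhat a \<noteq> 0" using \<delta>\<gamma> by (metis mult_zero_right zero_neq_one)
    fix a b c s t
    show "That (a + b) c = That a c + That b c" by (simp add: assms(13) C.T_add)
    show "That a (b + c) = That a b + That a c"
      by (simp add: assms(13) A.map_add A.T_add_right)
    show "That (scale s a) (scale t b) = s * \<sigma> t * That a b"
      by (simp add: assms(13) A.map_scale C.T_scale A.T_scale_right mult_ac)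
    show "\<sigma> (That a b) = That b a"
      using A.trace_map_hermitian[OF reduced torsion_free] by (simp add: assms(13))
    show "sharphat (scale t a) = scale ((\<sigma> t)\<^sup>2) (sharphat a)"
      by (simp add: assms(11) A.map_scale C.sharp_scale mult_ac)
    show "Nhat (scale t a) = t ^ 3 * Nhat a"
      by (simp add: assms(10) C.N_scale mult_ac)
    show "Nhat (a + b) = Nhat a + That b (sharphat a) + That a (sharphat b) + Nhat b"
      unfolding assms(10,13) \<phi>_sharphat
      by (simp add: C.N_add A.T_scale_right algebra_simps)
    have "\<gamma> * (unit_inv \<gamma>)\<^sup>2 = unit_inv \<gamma>"
      using \<gamma>_inv by (simp add: power2_eq_square flip: mult.assoc)
    then show "sharphat (sharphat a) = scale (Nhat a) a"
      unfolding assms(11)[of "sharphat a"] \<phi>_sharphat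
      by (simp add: C.sharp_scale C.sharp_sharp assms(10) flip: mult.assoc)
  qed
  moreover have "crosshat a b = sharp_cross sharphat a b" for a b
    by (simp add: assms(11,12) sharp_cross_def A.map_add C.scale_right_diff_distrib)
  moreover have "\<delta> \<in> range \<iota>" using quadratic_etale_fixed assms(3) \<sigma>\<delta> by blast
  ultimately show ?thesis by blast
qed

end
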